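(* Fix $q\in\mathbb R$. For every real $c>\max\big(-dq,1-dq,\dots,d-dq,\beta(q)\big)$ and every $0<r<r_{\min}$, $$V_{\mu,r}^{q,\mathrm{sym}}(K)=\sum_{l=0}^d\kappa_\mu^{q,l}(K)\,\sigma_{q,l}\,r^{-l+dq}\;+\;\frac1{2\pi\mathrm i}\int_{c-\mathrm i\infty}^{c+\mathrm i\infty}Z_\mu^q(s)\,r^{-s}\,ds .$$
   Context: Let $d\ge1$ and $N\ge2$ be integers, $S_1,\dots,S_N:\mathbb R^d\to\mathbb R^d$ contracting similarities with ratios $r_1,\dots,r_N\in(0,1)$, and $(p_1,\dots,p_N)$ a probability vector with all $p_i>0$. $K$ is the self-similar set ($K$ non-empty compact, $K=\bigcup_iS_i(K)$) and $\mu$ the self-similar measure ($\mu=\sum_ip_i\mu\circ S_i^{-1}$, a Borel probability measure). For $q\in\mathbb R$, $\beta(q)$ is the unique real number with $\sum_ip_i^qr_i^{\beta(q)}=1$. $r_{\min}=\min_ir_i$. $\Sigma^*$ is the set of all finite non-empty strings $\mathbf i=i_1\dots i_m$ over $\{1,\dots,N\}$; $r_{\mathbf i}=r_{i_1}\cdots r_{i_m}$, $p_{\mathbf i}=p_{i_1}\cdots p_{i_m}$, and $\hat{\mathbf i}=i_1\dots i_{m-1}$ is the parent of $\mathbf i$ (for the empty string $r_\varnothing=1$). For $l=0,1,\dots,d$ put $\sigma_{q,l}=\sum_{i=1}^Np_i^qr_i^{l-dq}$ and $$C_{\mu,r}^{q,l,\mathrm{sym}}(K)=\sum_{\mathbf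 i\in\Sigma^*,\ r_{\mathbf i}<r<r_{\hat{\mathbf i}}}p_{\mathbf i}^qr_{\mathbf i}^{l-dq}+\frac{1+\frac1{\sigma_{q,l}}}2\sum_{\mathbf i\in\Sigma^*,\ r=r_{\hat{\mathbf i}}}p_{\mathbf i}^qr_{\mathbf i}^{l-dq}.$$ Let $\kappa_\mu^{q,0}(K),\dots,\kappa_\mu^{q,d}(K)$ be arbitrary real numbers satisfying the consistency condition $\sum_{l=0}^d\kappa_\mu^{q,l}(K)(\sigma_{q,l}-1)=0$. The symbolic $q$ multifractal Minkowski volume is $$V_{\mu,r}^{q,\mathrm{sym}}(K)=\sum_{l=0}^d\kappa_\mu^{q,l}(K)\,C_{\mu,r}^{q,l,\mathrm{sym}}(K)\,r^{-l+dq}.$$ The multifractal zeta-function is the meromorphic function $\zeta_\mu^q(s)=\frac{\sum_ip_i^qr_i^s}{1-\sum_ip_i^qr_i^s}$ (equal to $\sum_{\mathbf i\in\Sigma^*}p_{\mathbf i}^qr_{\mathbf i}^s$ for $\operatorname{Re}s>\beta(q)$), and the modified zeta-function is $$Z_\mu^q(s)=\Big(\sum_{l=0}^d\frac{\kappa_\mu^{q,l}(K)(\sigma_{q,l}-1)}{s-(l-dq)}\Big)\zeta_\mu^q(s).$$ The integral $\int_{c-\mathrm i\infty}^{c+\mathrm i\infty}$ means $\lim_{t\to\infty}\int_{c-\mathrm it}^{c+\mathrm it}$ along the vertical line. *)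

theory Defs
  imports "HOL-Complex_Analysis.Complex_Analysis" "HOL-Probability.Probability_Measure"
begin

definition contracting_similarity :: "real \<Rightarrow> ('a::euclidean_space \<Rightarrow> 'a) \<Rightarrow> bool" where
  "contracting_similarity \<rho> S \<longleftrightarrow>
     0 < \<rho> \<and> \<rho> < 1 \<and> (\<forall>x y. dist (S x) (S y) = \<rho> * dist x y)"

definition self_similar_set ::
    "nat \<Rightarrow> (nat \<Rightarrow> 'a::euclidean_space \<Rightarrow> 'a) \<Rightarrow> 'a set \<Rightarrow> bool" where
  "self_similar_set N S K \<longleftrightarrow> K \<noteq> {} \<and> compact K \<and> K = (\<Union>i\<in>{1..N}. S i ` K)"

definition self_similar_measure ::
    "nat \<Rightarrow> (nat \<Rightarrow> 'a::euclidean_space \<Rightarrow> 'a) \<Rightarrow> (nat \<Rightarrow> real) \<Rightarrow> 'a measure \<Rightarrow> bool" where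
  "self_similar_measure N S p \<mu> \<longleftrightarrow>
     sets \<mu> = sets borel \<and> prob_space \<mu> \<and>
     (\<forall>A\<in>sets borel. emeasure \<mu> A = (\<Sum>i=1..N. ennreal (p i) * emeasure \<mu> (S i -` A)))"

definition words :: "nat \<Rightarrow> nat list set" where
  "words N = {w. w \<noteq> [] \<and> set w \<subseteq> {1..N}}"

text \<open>The value \<open>x\<^bsub>w\<^esub>\<close> of a weight family \<open>x\<close> (ratios or probabilities) along the word \<open>w\<close>;
  it is \<open>1\<close> on the empty word. The parent of \<open>w\<close> is \<open>butlast w\<close>.\<close>

definition word_prod :: "(nat \<Rightarrow> real) \<Rightarrow> nat list \<Rightarrow> real" where
  "word_prod x w = prod_list (map x w)"

definition mf_beta :: "nat \<Rightarrow> (nat \<Rightarrow> real) \<Rightarrow> (nat \<Rightarrow> real) \<Rightarrow> real \<Rightarrow> real" where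
  "mf_beta N \<rho> p q = (THE b. (\<Sum>i=1..N. p i powr q * \<rho> i powr b) = 1)"

definition mf_sigma ::
    "nat \<Rightarrow> (nat \<Rightarrow> real) \<Rightarrow> (nat \<Rightarrow> real) \<Rightarrow> nat \<Rightarrow> real \<Rightarrow> nat \<Rightarrow> real" where
  "mf_sigma N \<rho> p d q l = (\<Sum>i=1..N. p i powr q * \<rho> i powr (real l - real d * q))"

text \<open>For ratios in \<open>(0,1)\<close> and \<open>r > 0\<close> both index sets below are finite
  (lemma \<open>finite_words_parent_ge\<close>), so that \<open>sum\<close> has its proper meaning.\<close>

definition sym_curvature ::
    "nat \<Rightarrow> (nat \<Rightarrow> real) \<Rightarrow> (nat \<Rightarrow> real) \<Rightarrow> nat \<Rightarrow> real \<Rightarrow> nat \<Rightarrow> real \<Rightarrow> real" where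
  "sym_curvature N \<rho> p d q l r =
     (\<Sum>w | w \<in> words N \<and> word_prod \<rho> w < r \<and> r < word_prod \<rho> (butlast w).
        word_prod p w powr q * word_prod \<rho> w powr (real l - real d * q))
     + (1 + 1 / mf_sigma N \<rho> p d q l) / 2 *
     (\<Sum>w | w \<in> words N \<and> r = word_prod \<rho> (butlast w).
        word_prod p w powr q * word_prod \<rho> w powr (real l - real d * q))"

definition sym_minkowski_volume ::
    "nat \<Rightarrow> (nat \<Rightarrow> real) \<Rightarrow> (nat \<Rightarrow> real) \<Rightarrow> nat \<Rightarrow> real \<Rightarrow> (nat \<Rightarrow> real) \<Rightarrow> real \<Rightarrow> real" where
  "sym_minkowski_volume N \<rho> p d q \<kappa> r =
     (\<Sum>l=0..d. \<kappa> l * sym_curvature N \<rho> p d q l r * r powr (- real l + real d * q))"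

definition mf_zeta ::
    "nat \<Rightarrow> (nat \<Rightarrow> real) \<Rightarrow> (nat \<Rightarrow> real) \<Rightarrow> real \<Rightarrow> complex \<Rightarrow> complex" where
  "mf_zeta N \<rho> p q s =
     (\<Sum>i=1..N. of_real (p i powr q) * of_real (\<rho> i) powr s) /
     (1 - (\<Sum>i=1..N. of_real (p i powr q) * of_real (\<rho> i) powr s))"

definition modified_zeta ::
    "nat \<Rightarrow> (nat \<Rightarrow> real) \<Rightarrow> (nat \<Rightarrow> real) \<Rightarrow> nat \<Rightarrow> real \<Rightarrow> (nat \<Rightarrow> real) \<Rightarrow> complex \<Rightarrow> complex" where
  "modified_zeta N \<rho> p d q \<kappa> s =
     (\<Sum>l=0..d. of_real (\<kappa> l * (mf_sigma N \<rho> p d q l - 1)) / (s - of_real (real l - real d * q)))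
     * mf_zeta N \<rho> p q s"

text \<open>Convergence of the symmetric improper integral along the line \<open>Re s = c\<close>, including
  integrability over each segment (\<open>contour_integral\<close> is totalised to \<open>0\<close> otherwise).\<close>

definition has_vertical_integral :: "(complex \<Rightarrow> complex) \<Rightarrow> complex \<Rightarrow> real \<Rightarrow> bool" where
  "has_vertical_integral f I c \<longleftrightarrow>
     (\<forall>t>0. f contour_integrable_on linepath (Complex c (- t)) (Complex c t)) \<and>
     ((\<lambda>t. contour_integral (linepath (Complex c (- t)) (Complex c t)) f) \<longlongrightarrow> I) at_top"

lemma finite_words_parent_ge:
  fixes \<rho> :: "nat \<Rightarrow> real"
  assumes \<rho>: "\<And>i. i \<in> {1..N} \<Longrightarrow> 0 < \<rho> i \<and> \<rho> i < 1" and r: "0 < r"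
  shows "finite {w \<in> words N. r \<le> word_prod \<rho> (butlast w)}"
proof -
  define m where "m = Max (insert 0 (\<rho> ` {1..N}))"
  have m: "0 \<le> m" "m < 1" using \<rho> by (simp_all add: m_def)
  have m3: "\<rho> i \<le> m" if "i \<in> {1..N}" for i
    unfolding m_def by (rule Max_ge) (use that in auto)
  obtain n where n: "m ^ n < r"
    using real_arch_pow_inv[OF r m(2)] by blast
  have bound: "0 \<le> word_prod \<rho> w \<and> word_prod \<rho> w \<le> m ^ length w" if "set w \<subseteq> {1..N}" for w
    using that
  proof (induction w)
    case (Cons a w)
    have "0 \<le> \<rho> a" "\<rho> a \<le> m" using Cons.prems \<rho>[of a] m3[of a] by auto
    then show ?case using Cons m(1) by (auto simp: word_prod_def intro!: mult_mono)
  qed (simp add: word_prod_def)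
  have "length w \<le> n" if w: "w \<in> words N" "r \<le> word_prod \<rho> (butlast w)" for w
  proof (rule ccontr)
    assume "\<not> length w \<le> n"
    then have "n \<le> length (butlast w)" by simp
    then have "m ^ length (butlast w) \<le> m ^ n"
      using m by (intro power_decreasing) auto
    moreover have "set (butlast w) \<subseteq> {1..N}"
      using w(1) in_set_butlastD[of _ w] by (fastforce simp: words_def)
    ultimately show False using bound[of "butlast w"] w(2) n by linarith
  qed
  then have "{w \<in> words N. r \<le> word_prod \<rho> (butlast w)} \<subseteq> {w. set w \<subseteq> {1..N} \<and> length w \<le> n}"
    by (auto simp: words_def)
  then show ?thesis
    by (rule finite_subset) (rule finite_lists_length_le, simp)
qed

lemma mf_beta_ex1:
  fixes \<rho> p :: "nat \<Rightarrow> real"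
  assumes \<rho>: "\<And>i. i \<in> {1..N} \<Longrightarrow> 0 < \<rho> i \<and> \<rho> i < 1"
    and p: "\<And>i. i \<in> {1..N} \<Longrightarrow> 0 < p i" and N: "1 \<le> N"
  shows "\<exists>!b. (\<Sum>i=1..N. p i powr q * \<rho> i powr b) = 1"
proof -
  define f where "f b = (\<Sum>i=1..N. p i powr q * \<rho> i powr b)" for b :: real
  have anti: "f b < f a" if "a < b" for a b
    unfolding f_def
  proof (rule sum_strict_mono)
    fix i assume i: "i \<in> {1..N}"
    have "\<rho> i powr b < \<rho> i powr a"
      using \<rho>[OF i] that by (intro powr_less_mono') auto
    then show "p i powr q * \<rho> i powr b < p i powr q * \<rho> i powr a"
      using p[OF i] by (intro mult_strict_left_mono) auto
  qed (use N in auto)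
  have lim0: "(f \<longlongrightarrow> (\<Sum>i=1..N. p i powr q * 0)) at_top"
    unfolding f_def
  proof (intro tendsto_sum tendsto_mult tendsto_const)
    fix i assume i: "i \<in> {1..N}"
    have "filterlim (\<lambda>b. ln (\<rho> i) * b) at_bot at_top"
      by (rule filterlim_tendsto_neg_mult_at_bot[OF tendsto_const _ filterlim_ident])
        (use \<rho>[OF i] in auto)
    then have "((\<lambda>b. exp (ln (\<rho> i) * b)) \<longlongrightarrow> 0) at_top"
      by (rule filterlim_compose[OF exp_at_bot])
    then show "((\<lambda>b. \<rho> i powr b) \<longlongrightarrow> 0) at_top"
      using \<rho>[OF i] by (simp add: powr_def mult.commute)
  qed
  then have "eventually (\<lambda>b. f b < 1) at_top"
    by (intro order_tendstoD(2)) auto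
  then obtain b where b: "f b < 1" by (auto simp: eventually_at_top_linorder)
  define a where "a = - (q * ln (p 1)) / ln (\<rho> 1)"
  have 1: "1 \<in> {1..N}" using N by simp
  have "p 1 powr q * \<rho> 1 powr a = 1"
    using \<rho>[OF 1] p[OF 1] by (simp add: a_def powr_def flip: exp_add)
  then have a: "1 \<le> f a"
    unfolding f_def using 1
    by (subst sum.remove[OF _ 1]) (auto intro!: sum_nonneg)
  have cont: "continuous_on UNIV f"
    unfolding f_def using \<rho> by (intro continuous_intros) force
  have ab: "a \<le> b"
    using a b anti[of b a] by linarith
  have "\<exists>x\<ge>a. x \<le> b \<and> f x = 1"
    by (rule IVT2') (use a b ab cont in \<open>auto intro: continuous_on_subset\<close>)
  then obtain x where x: "f x = 1" by blast
  have "y = x" if "f y = 1" for y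
    using anti[of x y] anti[of y x] x that by (cases x y rule: linorder_cases) auto
  then show ?thesis using x unfolding f_def by blast
qed

end

theory Submission
  imports Defs
begin

text \<open>
  Write \<open>e\<^sub>l = l - d q\<close>, \<open>a\<^sub>l = \<kappa>\<^sub>l (\<sigma>\<^sub>l - 1)\<close> and \<open>R s = (\<Sum>l. a\<^sub>l / (s - e\<^sub>l))\<close>, so that the
  integrand is \<open>R s * \<zeta> s * r powr (- s)\<close>. The consistency condition says \<open>(\<Sum>l. a\<^sub>l) = 0\<close>, and it
  is used twice: it makes \<open>R\<close> decay quadratically, so that the line of integration may be pushed off
  to infinity on either side, and it makes the words \<open>w\<close> whose ratio \<open>\<rho>\<^sub>w\<close> is exactly \<open>r\<close>
  contribute nothing.

  Expanding \<open>\<zeta>\<close> into an infinite sum over words and integrating term by term is avoided by cutting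
  the tree of words at level \<open>r\<close>. Let \<open>W\<close> be the finite set of nonempty words with
  \<open>\<rho>\<^sub>w \<ge> r\<close>, and \<open>U\<close> the finite set of words with \<open>\<rho>\<^sub>w < r\<close> whose parent still has ratio at
  least \<open>r\<close>. A word whose parent is empty or in \<open>W\<close> lies in exactly one of \<open>W\<close> and \<open>U\<close>; as
  weights are multiplicative, the weight sums satisfy \<open>P (1 + S\<^sub>W) = S\<^sub>W + S\<^sub>U\<close>, with \<open>P\<close> the sum
  of the letter weights (lemma \<open>cut_set_identity\<close>). Solving for \<open>\<zeta> = P / (1 - P)\<close> gives
  \<open>\<zeta> = S\<^sub>W + S\<^sub>U / (1 - P)\<close> (lemma \<open>mf_zeta_cut_set\<close>).

  After multiplication by \<open>r powr (- s)\<close>, every summand of \<open>S\<^sub>W\<close> is a multiple of \<open>x powr s\<close> with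
  \<open>x = \<rho>\<^sub>w / r \<ge> 1\<close>. This is bounded to the left of the line, and shifting to the left picks up the
  residues at the \<open>e\<^sub>l\<close> (lemma \<open>vertical_integral_close_left\<close>). The summands of \<open>S\<^sub>U\<close> have \<open>x < 1\<close>
  and \<open>P \<noteq> 1\<close> beyond \<open>\<beta> q\<close>, so \<open>S\<^sub>U / (1 - P)\<close> contributes a function that is holomorphic and
  bounded to the right of the line and integrates to zero (lemma \<open>vertical_integral_close_right\<close>).
  Hence the integral, divided by \<open>2 \<pi> \<i>\<close>, is the sum over \<open>w \<in> W\<close> of
  \<open>p\<^sub>w powr q * (\<Sum>l. a\<^sub>l * (\<rho>\<^sub>w / r) powr e\<^sub>l)\<close>.

  The same counting of children, applied to real weights, evaluates the symbolic curvatures and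
  shows that the volume is the claimed power sum plus this very expression
  (lemma \<open>sym_minkowski_volume_eq\<close>).
\<close>

section \<open>Weight sums over the tree of words\<close>

text \<open>Every nonempty word is its parent followed by one letter, and the weight
  \<open>prod_list (map g w)\<close> is multiplicative; so a condition that only concerns the parent lets
  the sum over the last letter factor out.\<close>

lemma sum_words_by_parent:
  fixes g :: "nat \<Rightarrow> 'a::comm_semiring_1"
  shows "(\<Sum>w | w \<in> words N \<and> Q (butlast w). prod_list (map g w)) =
    (\<Sum>i=1..N. g i) * (\<Sum>v | v \<in> lists {1..N} \<and> Q v. prod_list (map g v))"
proof -
  have "(\<Sum>w | w \<in> words N \<and> Q (butlast w). prod_list (map g w)) =
        (\<Sum>(i, v) \<in> {1..N} \<times> {v. v \<in> lists {1..N} \<and> Q v}. prod_list (map g (v @ [i])))"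
  proof -
    have "w \<in> (\<lambda>(i, v). v @ [i]) ` ({1..N} \<times> {v. v \<in> lists {1..N} \<and> Q v})"
      if "w \<in> words N" "Q (butlast w)" for w
      using that by (cases w rule: rev_cases) (auto simp: words_def)
    then have "{w. w \<in> words N \<and> Q (butlast w)} =
        (\<lambda>(i, v). v @ [i]) ` ({1..N} \<times> {v. v \<in> lists {1..N} \<and> Q v})"
      by (auto simp: words_def)
    moreover have "inj_on (\<lambda>(i, v). v @ [i]) ({1..N} \<times> {v. v \<in> lists {1..N} \<and> Q v})"
      by (auto simp: inj_on_def)
    ultimately show ?thesis
      by (simp add: sum.reindex case_prod_unfold o_def)
  qed
  also have "\<dots> = (\<Sum>i=1..N. \<Sum>v | v \<in> lists {1..N} \<and> Q v. g i * prod_list (map g v))"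
    by (simp add: sum.cartesian_product mult.commute)
  finally show ?thesis
    by (simp add: sum_product)
qed

lemma lists_eq_insert_words: "lists {1..N} = insert [] (words N)"
  by (auto simp: words_def)

text \<open>The parent ranges over all words, including the empty one, whereas the
  sums of interest range over nonempty words. The empty parent has weight \<open>1\<close>; it is counted
  here and excluded in the companion lemma that follows.\<close>

lemma sum_words_by_parent_root:
  fixes g :: "nat \<Rightarrow> 'a::comm_semiring_1"
  assumes "Q []" "finite {w \<in> words N. Q w}"
  shows "(\<Sum>w | w \<in> words N \<and> Q (butlast w). prod_list (map g w)) =
    (\<Sum>i=1..N. g i) * (1 + (\<Sum>v | v \<in> words N \<and> Q v. prod_list (map g v)))"
proof -
  have "{v. v \<in> lists {1..N} \<and> Q v} = insert [] {w \<in> words N. Q w}"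
    using assms(1) unfolding lists_eq_insert_words by auto
  then show ?thesis
    unfolding sum_words_by_parent using assms(2) by (simp add: words_def)
qed

lemma sum_words_by_parent_no_root:
  fixes g :: "nat \<Rightarrow> 'a::comm_semiring_1"
  assumes "\<not> Q []"
  shows "(\<Sum>w | w \<in> words N \<and> Q (butlast w). prod_list (map g w)) =
    (\<Sum>i=1..N. g i) * (\<Sum>v | v \<in> words N \<and> Q v. prod_list (map g v))"
proof -
  have "{v. v \<in> lists {1..N} \<and> Q v} = {w. w \<in> words N \<and> Q w}"
    using assms unfolding lists_eq_insert_words by auto
  then show ?thesis unfolding sum_words_by_parent by simp
qed

lemma word_prod_pos:
  assumes "\<And>i. i \<in> {1..N} \<Longrightarrow> 0 < x i" "set w \<subseteq> {1..N}"
  shows "0 < word_prod x w"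
  using assms(2) by (induction w) (auto simp: word_prod_def intro!: mult_pos_pos assms(1))

lemma word_prod_less_parent:
  assumes \<rho>: "\<And>i. i \<in> {1..N} \<Longrightarrow> 0 < \<rho> i \<and> \<rho> i < 1" and w: "w \<in> words N"
  shows "word_prod \<rho> w < word_prod \<rho> (butlast w)"
proof -
  obtain v i where vi: "w = v @ [i]" "i \<in> {1..N}" "set v \<subseteq> {1..N}"
    using w by (cases w rule: rev_cases) (auto simp: words_def)
  have "0 < word_prod \<rho> v" using word_prod_pos[of N \<rho> v] \<rho> vi by blast
  then show ?thesis using \<rho>[OF vi(2)] by (simp add: vi(1) word_prod_def)
qed

lemma word_weight_eq_prod_list:
  assumes "\<And>i. i \<in> {1..N} \<Longrightarrow> 0 < \<rho> i" "\<And>i. i \<in> {1..N} \<Longrightarrow> 0 < p i" "set w \<subseteq> {1..N}"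
  shows "word_prod p w powr q * word_prod \<rho> w powr e = prod_list (map (\<lambda>i. p i powr q * \<rho> i powr e) w)"
  using assms(3)
proof (induction w)
  case (Cons i w)
  have "0 < word_prod p w" "0 < word_prod \<rho> w"
    using Cons.prems by (auto intro!: word_prod_pos[of N] assms)
  with Cons assms(1,2)[of i] show ?case
    by (auto simp: word_prod_def powr_mult mult_ac)
qed (simp add: word_prod_def)

lemma word_weight_eq_prod_list_complex:
  fixes s :: complex
  assumes "\<And>i. i \<in> {1..N} \<Longrightarrow> 0 < \<rho> i" "\<And>i. i \<in> {1..N} \<Longrightarrow> 0 < p i" "set w \<subseteq> {1..N}"
  shows "of_real (word_prod p w powr q) * of_real (word_prod \<rho> w) powr s
       = prod_list (map (\<lambda>i. of_real (p i powr q) * of_real (\<rho> i) powr s) w)"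
  using assms(3)
proof (induction w)
  case (Cons i w)
  have "0 < word_prod p w" "0 < word_prod \<rho> w" "0 < \<rho> i" "0 < p i"
    using Cons.prems by (auto intro!: word_prod_pos[of N] assms)
  then have "of_real (word_prod p (i # w) powr q) * of_real (word_prod \<rho> (i # w)) powr s =
      (of_real (p i powr q) * of_real (\<rho> i) powr s) *
      (of_real (word_prod p w powr q) * of_real (word_prod \<rho> w) powr s :: complex)"
    by (simp add: word_prod_def powr_mult powr_times_real mult_ac)
  with Cons show ?case by simp
qed (simp add: word_prod_def)

lemma finite_words_ge:
  assumes \<rho>: "\<And>i. i \<in> {1..N} \<Longrightarrow> 0 < \<rho> i \<and> \<rho> i < 1" and r: "0 < r"
  shows "finite {w \<in> words N. r \<le> word_prod \<rho> w}"
  by (rule finite_subset[OF _ finite_words_parent_ge[of N \<rho>, OF \<rho> r]])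
     (use word_prod_less_parent[of N \<rho>, OF \<rho>] in force)+

text \<open>The words whose parent has ratio at least \<open>r\<close> are those of ratio at
  least \<open>r\<close> together with the ones at which the ratio first drops below \<open>r\<close>. Read as an equation
  for the geometric quotient \<open>P / (1 - P)\<close>, with \<open>P\<close> the sum of the letter weights, this replaces
  the infinite series over all words by two finite sums.\<close>

lemma cut_set_identity:
  fixes g :: "nat \<Rightarrow> 'a::comm_ring_1"
  assumes \<rho>: "\<And>i. i \<in> {1..N} \<Longrightarrow> 0 < \<rho> i \<and> \<rho> i < 1" and r: "0 < r" "r < 1"
  shows "(\<Sum>i=1..N. g i) * (1 + (\<Sum>w | w \<in> words N \<and> r \<le> word_prod \<rho> w. prod_list (map g w))) =
      (\<Sum>w | w \<in> words N \<and> r \<le> word_prod \<rho> w. prod_list (map g w))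
    + (\<Sum>w | w \<in> words N \<and> word_prod \<rho> w < r \<and> r \<le> word_prod \<rho> (butlast w). prod_list (map g w))"
proof -
  note lt = word_prod_less_parent[of N \<rho>, OF \<rho>]
  have "(\<Sum>i=1..N. g i) * (1 + (\<Sum>w | w \<in> words N \<and> r \<le> word_prod \<rho> w. prod_list (map g w))) =
      (\<Sum>w | w \<in> words N \<and> r \<le> word_prod \<rho> (butlast w). prod_list (map g w))"
    by (rule sum_words_by_parent_root[symmetric])
       (use r finite_words_ge[OF \<rho> r(1)] in \<open>auto simp: word_prod_def\<close>)
  also have "{w. w \<in> words N \<and> r \<le> word_prod \<rho> (butlast w)} =
      {w. w \<in> words N \<and> r \<le> word_prod \<rho> w} \<union>
      {w. w \<in> words N \<and> word_prod \<rho> w < r \<and> r \<le> word_prod \<rho> (butlast w)}"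
    using lt by (force simp: not_le)
  also have "(\<Sum>w\<in>\<dots>. prod_list (map g w)) =
      (\<Sum>w | w \<in> words N \<and> r \<le> word_prod \<rho> w. prod_list (map g w))
    + (\<Sum>w | w \<in> words N \<and> word_prod \<rho> w < r \<and> r \<le> word_prod \<rho> (butlast w). prod_list (map g w))"
    by (intro sum.union_disjoint finite_words_ge[OF \<rho> r(1)]
          finite_subset[OF _ finite_words_parent_ge[OF \<rho> r(1)]]) auto
  finally show ?thesis .
qed

text \<open>Let \<open>A\<close>, \<open>E\<close>, \<open>B\<close> be the weight sums over the words with \<open>r < \<rho>\<^sub>w\<close>, with
  \<open>r = \<rho>\<^sub>w\<close>, and with \<open>\<rho>\<^sub>w < r\<close> strictly below the ratio of the parent. Words grouped
  by parent give \<open>\<sigma> (1 + A) = A + E + B\<close> for the parents above \<open>r\<close>, while the parents equal to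
  \<open>r\<close> yield \<open>\<sigma> E\<close>. The factor \<open>(1 + 1 / \<sigma>) / 2\<close> in the definition is the one that turns the
  combined contribution of \<open>E\<close> into a multiple of \<open>\<sigma> - 1\<close>, just like that of \<open>A\<close>.\<close>

lemma sym_curvature_eq:
  fixes \<rho> p :: "nat \<Rightarrow> real" and d l N :: nat and q r :: real
  defines "e \<equiv> real l - real d * q"
  assumes \<rho>: "\<And>i. i \<in> {1..N} \<Longrightarrow> 0 < \<rho> i \<and> \<rho> i < 1" and p: "\<And>i. i \<in> {1..N} \<Longrightarrow> 0 < p i"
    and N: "1 \<le> N" and r: "0 < r" "r < 1"
  shows "sym_curvature N \<rho> p d q l r = mf_sigma N \<rho> p d q l + (mf_sigma N \<rho> p d q l - 1) *
      ((\<Sum>w | w \<in> words N \<and> r < word_prod \<rho> w. word_prod p w powr q * word_prod \<rho> w powr e)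
     + (\<Sum>w | w \<in> words N \<and> r = word_prod \<rho> w. word_prod p w powr q * word_prod \<rho> w powr e) / 2)"
proof -
  define \<sigma> where "\<sigma> = mf_sigma N \<rho> p d q l"
  define g where "g = (\<lambda>i. p i powr q * \<rho> i powr e)"
  define T where "T = (\<lambda>Q. \<Sum>w | w \<in> words N \<and> Q w. prod_list (map g w))"
  define A where "A = T (\<lambda>w. r < word_prod \<rho> w)"
  define E where "E = T (\<lambda>w. r = word_prod \<rho> w)"
  define U where "U = T (\<lambda>w. word_prod \<rho> w < r \<and> r < word_prod \<rho> (butlast w))"
  note lt = word_prod_less_parent[of N \<rho>, OF \<rho>]
  have fin: "finite {w. w \<in> words N \<and> Q w}"
    if "\<And>w. w \<in> words N \<Longrightarrow> Q w \<Longrightarrow> r \<le> word_prod \<rho> (butlast w)" for Q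
    by (rule finite_subset[OF _ finite_words_parent_ge[OF \<rho> r(1)]]) (use that in auto)
  have T: "(\<Sum>w | w \<in> words N \<and> Q w. word_prod p w powr q * word_prod \<rho> w powr e) = T Q" for Q
    unfolding T_def g_def
    by (rule sum.cong[OF refl], rule word_weight_eq_prod_list[OF \<rho>[THEN conjunct1] p])
       (auto simp: words_def)
  have \<sigma>: "\<sigma> = (\<Sum>i=1..N. g i)" by (simp add: \<sigma>_def g_def e_def mf_sigma_def)
  have "0 < \<sigma>" unfolding \<sigma> g_def
  proof (rule sum_pos)
    show "0 < p i powr q * \<rho> i powr e" if "i \<in> {1..N}" for i
      using \<rho>[OF that] p[OF that] by simp
  qed (use N in auto)
  have "\<sigma> * (1 + A) = T (\<lambda>w. r < word_prod \<rho> (butlast w))"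
    unfolding \<sigma> A_def T_def
  proof (rule sum_words_by_parent_root[symmetric])
    show "r < word_prod \<rho> []" using r by (simp add: word_prod_def)
    show "finite {w \<in> words N. r < word_prod \<rho> w}" by (rule fin) (use lt in force)
  qed
  also have "\<dots> = A + E + U"
  proof -
    have "{w. w \<in> words N \<and> r < word_prod \<rho> (butlast w)} =
        ({w. w \<in> words N \<and> r < word_prod \<rho> w} \<union> {w. w \<in> words N \<and> r = word_prod \<rho> w}) \<union>
         {w. w \<in> words N \<and> word_prod \<rho> w < r \<and> r < word_prod \<rho> (butlast w)}" (is "_ = (?X \<union> ?Y) \<union> ?Z")
      using lt by force
    moreover have "finite ?X" "finite ?Y" "finite ?Z"
      by (rule fin, use lt in force)+
    ultimately show ?thesis
      unfolding A_def E_def U_def T_def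
      by (subst sum.union_disjoint[symmetric] | force)+
  qed
  finally have U: "U = \<sigma> * (1 + A) - A - E" by simp
  have "T (\<lambda>w. r = word_prod \<rho> (butlast w)) = \<sigma> * E"
    unfolding \<sigma> E_def T_def
    using sum_words_by_parent_no_root[where Q = "\<lambda>w. r = word_prod \<rho> w" and N = N and g = g] r
    by (simp add: word_prod_def[of _ "[]"])
  then have "sym_curvature N \<rho> p d q l r = U + (1 + 1 / \<sigma>) / 2 * (\<sigma> * E)"
    unfolding sym_curvature_def e_def[symmetric] T U_def \<sigma>_def by simp
  also have "\<dots> = \<sigma> + (\<sigma> - 1) * (A + E / 2)"
    using \<open>0 < \<sigma>\<close> by (simp add: U field_simps)
  finally show ?thesis
    unfolding T \<sigma>_def A_def E_def .
qed

text \<open>Each coefficient \<open>\<kappa>\<^sub>l (\<sigma>\<^sub>l - 1)\<close> now multiplies a weight sum in which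
  words with \<open>\<rho>\<^sub>w = r\<close> count one half. For such a word the powers \<open>(\<rho>\<^sub>w / r) powr e\<^sub>l\<close>
  are all \<open>1\<close>, so its total contribution vanishes by the consistency condition and the half may be
  replaced by a full count.\<close>

lemma sym_minkowski_volume_eq:
  fixes \<rho> p \<kappa> :: "nat \<Rightarrow> real" and d N :: nat and q r :: real
  assumes \<rho>: "\<And>i. i \<in> {1..N} \<Longrightarrow> 0 < \<rho> i \<and> \<rho> i < 1" and p: "\<And>i. i \<in> {1..N} \<Longrightarrow> 0 < p i"
    and N: "1 \<le> N" and r: "0 < r" "r < 1"
    and \<kappa>: "(\<Sum>l=0..d. \<kappa> l * (mf_sigma N \<rho> p d q l - 1)) = 0"
  shows "sym_minkowski_volume N \<rho> p d q \<kappa> r =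
      (\<Sum>l=0..d. \<kappa> l * mf_sigma N \<rho> p d q l * r powr (- real l + real d * q))
    + (\<Sum>w | w \<in> words N \<and> r \<le> word_prod \<rho> w. word_prod p w powr q *
        (\<Sum>l=0..d. \<kappa> l * (mf_sigma N \<rho> p d q l - 1) * (word_prod \<rho> w / r) powr (real l - real d * q)))"
proof -
  define a where "a = (\<lambda>l. \<kappa> l * (mf_sigma N \<rho> p d q l - 1))"
  define e where "e = (\<lambda>l. real l - real d * q)"
  define F where "F = (\<lambda>w. word_prod p w powr q * (\<Sum>l=0..d. a l * (word_prod \<rho> w / r) powr e l))"
  define A where "A = {w. w \<in> words N \<and> r < word_prod \<rho> w}"
  define E where "E = {w. w \<in> words N \<and> r = word_prod \<rho> w}"
  define t where "t = (\<lambda>l w. word_prod p w powr q * word_prod \<rho> w powr e l)"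
  have me: "- real l + real d * q = - e l" for l by (simp add: e_def)
  have F: "(\<Sum>l=0..d. a l * r powr (- e l) * sum (t l) X) = sum F X" if "X \<subseteq> words N" for X
  proof -
    have "(\<Sum>l=0..d. a l * r powr (- e l) * sum (t l) X) =
        (\<Sum>w\<in>X. \<Sum>l=0..d. a l * r powr (- e l) * t l w)"
      by (simp add: sum_distrib_left sum.swap[of _ X])
    also have "\<dots> = sum F X"
    proof (rule sum.cong[OF refl])
      fix w assume "w \<in> X"
      then have "0 < word_prod \<rho> w"
        using that \<rho> by (intro word_prod_pos[of N]) (auto simp: words_def)
      then show "(\<Sum>l=0..d. a l * r powr (- e l) * t l w) = F w"
        using r(1) unfolding F_def t_def sum_distrib_left
        by (intro sum.cong refl) (simp add: powr_divide powr_minus field_simps)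
    qed
    finally show ?thesis .
  qed
  \<comment> \<open>On E all powers equal 1, leaving only the sum of the coefficients.\<close>
  have "F w = 0" if "w \<in> E" for w
    using that \<kappa> r by (simp add: F_def E_def a_def)
  then have E0: "sum F E = 0" by simp
  have "sym_minkowski_volume N \<rho> p d q \<kappa> r =
      (\<Sum>l=0..d. \<kappa> l * mf_sigma N \<rho> p d q l * r powr (- e l)
        + a l * r powr (- e l) * sum (t l) A + a l * r powr (- e l) * sum (t l) E / 2)"
    unfolding sym_minkowski_volume_def
  proof (rule sum.cong[OF refl])
    fix l
    have curv: "sym_curvature N \<rho> p d q l r = mf_sigma N \<rho> p d q l
        + (mf_sigma N \<rho> p d q l - 1) * (sum (t l) A + sum (t l) E / 2)"
      unfolding t_def A_def E_def e_def by (rule sym_curvature_eq[OF \<rho> p N r])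
    show "\<kappa> l * sym_curvature N \<rho> p d q l r * r powr (- real l + real d * q) =
        \<kappa> l * mf_sigma N \<rho> p d q l * r powr (- e l)
        + a l * r powr (- e l) * sum (t l) A + a l * r powr (- e l) * sum (t l) E / 2"
      unfolding me curv a_def by (simp add: field_simps)
  qed
  also have "\<dots> = (\<Sum>l=0..d. \<kappa> l * mf_sigma N \<rho> p d q l * r powr (- e l))
        + (\<Sum>l=0..d. a l * r powr (- e l) * sum (t l) A)
        + (\<Sum>l=0..d. a l * r powr (- e l) * sum (t l) E) / 2"
    by (simp only: sum.distrib sum_divide_distrib)
  also have "\<dots> = (\<Sum>l=0..d. \<kappa> l * mf_sigma N \<rho> p d q l * r powr (- e l)) + sum F A"
    using F[of A] F[of E] E0 by (auto simp: A_def E_def)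
  also have "sum F A = sum F (A \<union> E)"
  proof -
    have "A \<union> E = {w \<in> words N. r \<le> word_prod \<rho> w}" by (auto simp: A_def E_def)
    then have "finite (A \<union> E)" using finite_words_ge[OF \<rho> r(1)] by simp
    then have "sum F (A \<union> E) = sum F A + sum F E"
      by (intro sum.union_disjoint) (auto simp: A_def E_def)
    then show ?thesis using E0 by simp
  qed
  also have "A \<union> E = {w. w \<in> words N \<and> r \<le> word_prod \<rho> w}" by (auto simp: A_def E_def)
  finally show ?thesis unfolding F_def a_def me e_def by simp
qed

section \<open>Moving a vertical line of integration to infinity\<close>

lemma has_vertical_integral_add:
  assumes "has_vertical_integral f I c" "has_vertical_integral g J c"
  shows "has_vertical_integral (\<lambda>s. f s + g s) (I + J) c"
proof -
  have f: "f contour_integrable_on linepath (Complex c (- t)) (Complex c t)"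
    and g: "g contour_integrable_on linepath (Complex c (- t)) (Complex c t)" if "t > 0" for t
    using assms that by (auto simp: has_vertical_integral_def)
  have "((\<lambda>t. contour_integral (linepath (Complex c (- t)) (Complex c t)) f
            + contour_integral (linepath (Complex c (- t)) (Complex c t)) g) \<longlongrightarrow> I + J) at_top"
    using assms by (intro tendsto_add) (auto simp: has_vertical_integral_def)
  moreover have "eventually (\<lambda>t. contour_integral (linepath (Complex c (- t)) (Complex c t)) f
      + contour_integral (linepath (Complex c (- t)) (Complex c t)) g
      = contour_integral (linepath (Complex c (- t)) (Complex c t)) (\<lambda>s. f s + g s)) at_top"
    using eventually_gt_at_top[of 0] by eventually_elim (simp add: contour_integral_add f g)
  ultimately show ?thesis
    unfolding has_vertical_integral_def
    using f g by (auto intro: contour_integrable_add Lim_transform_eventually)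
qed

lemma has_vertical_integral_cmult:
  assumes "has_vertical_integral f I c"
  shows "has_vertical_integral (\<lambda>s. k * f s) (k * I) c"
proof -
  have f: "f contour_integrable_on linepath (Complex c (- t)) (Complex c t)" if "t > 0" for t
    using assms that by (auto simp: has_vertical_integral_def)
  have "((\<lambda>t. k * contour_integral (linepath (Complex c (- t)) (Complex c t)) f) \<longlongrightarrow> k * I) at_top"
    using assms by (intro tendsto_mult_left) (auto simp: has_vertical_integral_def)
  moreover have "eventually (\<lambda>t. k * contour_integral (linepath (Complex c (- t)) (Complex c t)) f
      = contour_integral (linepath (Complex c (- t)) (Complex c t)) (\<lambda>s. k * f s)) at_top"
    using eventually_gt_at_top[of 0] by eventually_elim (simp add: contour_integral_lmul f)
  ultimately show ?thesis
    unfolding has_vertical_integral_def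
    using f by (auto intro: contour_integrable_lmul Lim_transform_eventually)
qed

lemma has_vertical_integral_zero: "has_vertical_integral (\<lambda>s. 0) 0 c"
  unfolding has_vertical_integral_def contour_integrable_on_def
  using has_contour_integral_0 by (auto simp: contour_integral_eq_0)

lemma has_vertical_integral_sum:
  assumes "finite A" "\<And>x. x \<in> A \<Longrightarrow> has_vertical_integral (f x) (I x) c"
  shows "has_vertical_integral (\<lambda>s. \<Sum>x\<in>A. f x s) (\<Sum>x\<in>A. I x) c"
  using assms
  by (induction A rule: finite_induct)
     (simp_all add: has_vertical_integral_zero has_vertical_integral_add)

lemma segment_vertical:
  assumes "s \<in> closed_segment (Complex x a) (Complex x b)"
  shows "Re s = x \<and> Im s \<in> closed_segment a b"
  using assms by (auto simp: closed_segment_same_Re)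

lemma segment_horizontal:
  assumes "s \<in> closed_segment (Complex a y) (Complex b y)"
  shows "Im s = y \<and> Re s \<in> closed_segment a b"
  using assms by (auto simp: closed_segment_same_Im)

lemma has_vertical_integral_cong:
  assumes "has_vertical_integral f I c" "\<And>s. Re s = c \<Longrightarrow> f s = g s"
  shows "has_vertical_integral g I c"
proof -
  have eq: "f s = g s" if "s \<in> path_image (linepath (Complex c (- t)) (Complex c t))" for s t
    using that assms(2) segment_vertical by (metis path_image_linepath)
  have "contour_integral (linepath (Complex c (- t)) (Complex c t)) f =
        contour_integral (linepath (Complex c (- t)) (Complex c t)) g" for t
    by (rule contour_integral_eq) (rule eq)
  moreover have "g contour_integrable_on linepath (Complex c (- t)) (Complex c t)" if "t > 0" for t
    by (rule contour_integrable_eq[OF _ eq]) (use assms(1) that in \<open>auto simp: has_vertical_integral_def\<close>)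
  ultimately show ?thesis
    using assms(1) by (simp add: has_vertical_integral_def)
qed

lemma contour_integral_rectpath_split:
  fixes x x' y y' :: real
  assumes le: "x \<le> x'" "y \<le> y'"
    and cont: "continuous_on (path_image (rectpath (Complex x y) (Complex x' y'))) f"
  shows "contour_integral (rectpath (Complex x y) (Complex x' y')) f =
      contour_integral (linepath (Complex x y) (Complex x' y)) f
    + contour_integral (linepath (Complex x' y) (Complex x' y')) f
    + contour_integral (linepath (Complex x' y') (Complex x y')) f
    + contour_integral (linepath (Complex x y') (Complex x y)) f"
proof -
  have img: "path_image (rectpath (Complex x y) (Complex x' y')) =
      closed_segment (Complex x y) (Complex x' y) \<union> closed_segment (Complex x' y) (Complex x' y')
    \<union> closed_segment (Complex x' y') (Complex x y') \<union> closed_segment (Complex x y') (Complex x y)"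
    by (simp add: rectpath_def Let_def path_image_join Un_assoc)
  have int: "f contour_integrable_on linepath a b"
    if "closed_segment a b \<subseteq> path_image (rectpath (Complex x y) (Complex x' y'))" for a b
    by (rule contour_integrable_continuous_linepath) (rule continuous_on_subset[OF cont that])
  have "f contour_integrable_on linepath (Complex x y) (Complex x' y)"
       "f contour_integrable_on linepath (Complex x' y) (Complex x' y')"
       "f contour_integrable_on linepath (Complex x' y') (Complex x y')"
       "f contour_integrable_on linepath (Complex x y') (Complex x y)"
    by (intro int; unfold img; blast)+
  then show ?thesis
    by (simp add: rectpath_def Let_def contour_integrable_joinI)
qed

lemma norm_diff_of_real_ge: "\<bar>Re s - c\<bar> \<le> norm (s - of_real c)" "\<bar>Im s\<bar> \<le> norm (s - of_real c)"
  using abs_Re_le_cmod[of "s - of_real c"] abs_Im_le_cmod[of "s - of_real c"] by simp_all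

text \<open>The number \<open>\<tau> = 1\<close> or \<open>\<tau> = -1\<close> selects the half-plane to
  the right or to the left of the line. The segment from \<open>c - \<i> t\<close> to \<open>c + \<i> t\<close> is completed by the
  other three sides of the rectangle of width \<open>t\<close>. These have total length \<open>4 t\<close> and keep a distance
  of at least \<open>t\<close> from \<open>c\<close>, so quadratic decay bounds their integral by \<open>4 C / t\<close>, and only the
  value \<open>J\<close> of the closed contour survives.\<close>

lemma has_vertical_integral_rectangle_shift:
  fixes \<tau> c C T :: real
  defines "D \<equiv> {s. 0 \<le> \<tau> * (Re s - c) \<and> (Re s = c \<or> T \<le> norm (s - of_real c))}"
  assumes \<tau>: "\<bar>\<tau>\<bar> = 1" and C: "0 \<le> C"
    and cont: "continuous_on D f"
    and decay: "\<And>s. s \<in> D \<Longrightarrow> T \<le> norm (s - of_real c) \<Longrightarrow> norm (f s) \<le> C / (norm (s - of_real c))\<^sup>2"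
    and cauchy: "eventually (\<lambda>t.
        contour_integral (linepath (Complex c (-t)) (Complex c t)) f
        - (contour_integral (linepath (Complex c (-t)) (Complex (c + \<tau> * t) (-t))) f
         + contour_integral (linepath (Complex (c + \<tau> * t) (-t)) (Complex (c + \<tau> * t) t)) f
         + contour_integral (linepath (Complex (c + \<tau> * t) t) (Complex c t)) f) = J) at_top"
  shows "has_vertical_integral f J c"
proof -
  define V where "V = (\<lambda>t. contour_integral (linepath (Complex c (-t)) (Complex c t)) f)"
  have int: "f contour_integrable_on linepath a b" if "closed_segment a b \<subseteq> D" for a b
    by (rule contour_integrable_continuous_linepath) (rule continuous_on_subset[OF cont that])
  have side: "norm (contour_integral (linepath a b) f) \<le> C / t\<^sup>2 * norm (b - a)"
    if "0 < t" and ab: "\<And>s. s \<in> closed_segment a b \<Longrightarrow> s \<in> D \<and> T \<le> norm (s - of_real c) \<and> t \<le> norm (s - of_real c)"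
    for a b t
  proof (rule contour_integral_bound_linepath)
    show "f contour_integrable_on linepath a b" using ab by (intro int) auto
    show "0 \<le> C / t\<^sup>2" using C by simp
    fix s assume s: "s \<in> closed_segment a b"
    have "norm (f s) \<le> C / (norm (s - of_real c))\<^sup>2" using ab[OF s] decay by blast
    also have "\<dots> \<le> C / t\<^sup>2"
      using ab[OF s] \<open>0 < t\<close> C by (intro divide_left_mono power_mono mult_pos_pos zero_less_power) auto
    finally show "norm (f s) \<le> C / t\<^sup>2" .
  qed
  have bound: "eventually (\<lambda>t. norm (V t - J) \<le> 4 * C / t) at_top"
    using cauchy eventually_ge_at_top[of T] eventually_gt_at_top[of 0]
  proof eventually_elim
    case (elim t)
    have t: "0 < t" "T \<le> t" using elim by auto
    let ?p = "c + \<tau> * t"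
    have tau: "\<tau> * \<tau> = 1" using \<tau> by (cases "\<tau> \<ge> 0") auto
    have hor: "s \<in> D \<and> T \<le> norm (s - of_real c) \<and> t \<le> norm (s - of_real c)"
      if "Im s = y" "\<bar>y\<bar> = t" "Re s \<in> closed_segment c ?p" for s y
    proof -
      have "t \<le> norm (s - of_real c)" using norm_diff_of_real_ge(2)[of s c] that by simp
      moreover have "0 \<le> \<tau> * (Re s - c)"
      proof -
        from that(3) obtain u where u: "0 \<le> u" "Re s = (1 - u) * c + u * ?p"
          by (auto simp: closed_segment_def)
        have "\<tau> * (Re s - c) = u * t * (\<tau> * \<tau>)" by (simp add: u algebra_simps)
        then show ?thesis using u t tau by simp
      qed
      ultimately show ?thesis using t by (auto simp: D_def)
    qed
    have ver: "s \<in> D \<and> T \<le> norm (s - of_real c) \<and> t \<le> norm (s - of_real c)"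
      if "Re s = ?p" for s
    proof -
      have "t \<le> norm (s - of_real c)"
        using norm_diff_of_real_ge(1)[of s c] that \<tau> t by (simp add: abs_mult)
      moreover have "0 \<le> \<tau> * (Re s - c)" using that tau t by (simp add: mult.assoc[symmetric])
      ultimately show ?thesis using t by (auto simp: D_def)
    qed
    have n1: "norm (contour_integral (linepath (Complex c (-t)) (Complex ?p (-t))) f) \<le> C / t\<^sup>2 * t"
    proof -
      have "norm (Complex ?p (-t) - Complex c (-t)) = t" using \<tau> t by (simp add: cmod_def abs_mult)
      then show ?thesis
        using side[OF t(1), of "Complex c (-t)" "Complex ?p (-t)"] hor segment_horizontal t by simp
    qed
    have n3: "norm (contour_integral (linepath (Complex ?p t) (Complex c t)) f) \<le> C / t\<^sup>2 * t"
    proof -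
      have "norm (Complex c t - Complex ?p t) = t" using \<tau> t by (simp add: cmod_def abs_mult)
      then show ?thesis
        using side[OF t(1), of "Complex ?p t" "Complex c t"] hor segment_horizontal t
        by (simp add: closed_segment_commute)
    qed
    have n2: "norm (contour_integral (linepath (Complex ?p (-t)) (Complex ?p t)) f) \<le> C / t\<^sup>2 * (2 * t)"
    proof -
      have "norm (Complex ?p t - Complex ?p (-t)) = 2 * t" using t by (simp add: cmod_def real_sqrt_mult)
      then show ?thesis
        using side[OF t(1), of "Complex ?p (-t)" "Complex ?p t"] ver segment_vertical by simp
    qed
    have "V t - J = contour_integral (linepath (Complex c (-t)) (Complex ?p (-t))) f
         + contour_integral (linepath (Complex ?p (-t)) (Complex ?p t)) f
         + contour_integral (linepath (Complex ?p t) (Complex c t)) f"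
      using elim by (simp add: V_def algebra_simps)
    also have "norm \<dots> \<le> C / t\<^sup>2 * t + C / t\<^sup>2 * (2 * t) + C / t\<^sup>2 * t"
      by (intro norm_triangle_mono n1 n2 n3)
    also have "\<dots> = 4 * C / t" using t by (simp add: power2_eq_square field_simps)
    finally show ?case .
  qed
  have "((\<lambda>t. 4 * C / t) \<longlongrightarrow> 0) at_top"
    by (intro tendsto_divide_0[OF tendsto_const] filterlim_at_top_imp_at_infinity filterlim_ident)
  then have "((\<lambda>t. V t - J) \<longlongrightarrow> 0) at_top"
    by (rule Lim_null_comparison[OF bound])
  then have "(V \<longlongrightarrow> J) at_top" by (simp add: LIM_zero_iff)
  moreover have "f contour_integrable_on linepath (Complex c (-t)) (Complex c t)" for t
    by (rule int) (auto simp: D_def dest: segment_vertical)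
  ultimately show ?thesis unfolding has_vertical_integral_def V_def by blast
qed

text \<open>Since the coefficients add up to zero, \<open>(\<Sum>l. a l) / (s - c)\<close> can be
  subtracted from the sum of fractions; each difference
  \<open>a l / (s - e l) - a l / (s - c)\<close> is \<open>a l * (e l - c) / ((s - e l) * (s - c))\<close>.\<close>

lemma simple_fractions_decay:
  fixes a :: "'i \<Rightarrow> complex" and e :: "'i \<Rightarrow> real" and c :: real
  assumes "finite A" "sum a A = 0"
  obtains C T where "0 \<le> C" "0 < T" "\<And>l. l \<in> A \<Longrightarrow> \<bar>e l - c\<bar> < T"
    "\<And>s. T \<le> norm (s - of_real c) \<Longrightarrow>
       norm (\<Sum>l\<in>A. a l / (s - of_real (e l))) \<le> C / (norm (s - of_real c))\<^sup>2"
proof -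
  define m where "m = (\<Sum>l\<in>A. \<bar>e l - c\<bar>)"
  define C where "C = (\<Sum>l\<in>A. 2 * norm (a l) * \<bar>e l - c\<bar>)"
  have m: "\<bar>e l - c\<bar> \<le> m" if "l \<in> A" for l
    unfolding m_def using assms(1) that by (intro member_le_sum) auto
  have m0: "0 \<le> m" by (simp add: m_def sum_nonneg)
  \<comment> \<open>Every pole lies within m of c, so a point more than 2 m away from c is at least half as far
    from each pole as it is from c.\<close>
  have bound: "norm (\<Sum>l\<in>A. a l / (s - of_real (e l))) \<le> C / (norm (s - of_real c))\<^sup>2"
    if s: "2 * m + 1 \<le> norm (s - of_real c)" for s :: complex
  proof -
    define n where "n = norm (s - of_real c)"
    have n: "0 < n" "2 * m + 1 \<le> n" using s m0 by (auto simp: n_def)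
    have far: "n / 2 \<le> norm (s - of_real (e l))" if "l \<in> A" for l
    proof -
      have "n \<le> norm (s - of_real (e l)) + norm (of_real (e l) - of_real c :: complex)"
        unfolding n_def using norm_triangle_ineq[of "s - of_real (e l)" "of_real (e l) - of_real c"] by simp
      moreover have "norm (of_real (e l) - of_real c :: complex) = \<bar>e l - c\<bar>"
        by (metis norm_of_real of_real_diff)
      ultimately show ?thesis using m[OF that] n m0 by linarith
    qed
    have nz: "s - of_real c \<noteq> 0" using n by (auto simp: n_def)
    have nz': "s - of_real (e l) \<noteq> 0" if "l \<in> A" for l
      using n(1) far[OF that] by (metis half_gt_zero norm_zero not_less)
    have "(\<Sum>l\<in>A. a l / (s - of_real (e l))) = (\<Sum>l\<in>A. a l / (s - of_real (e l))) - (\<Sum>l\<in>A. a l) / (s - of_real c)"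
      using assms(2) by simp
    also have "\<dots> = (\<Sum>l\<in>A. a l * of_real (e l - c) / ((s - of_real (e l)) * (s - of_real c)))"
      unfolding sum_divide_distrib sum_subtractf[symmetric]
    proof (rule sum.cong[OF refl])
      fix l assume "l \<in> A"
      then show "a l / (s - of_real (e l)) - a l / (s - of_real c)
          = a l * of_real (e l - c) / ((s - of_real (e l)) * (s - of_real c))"
        using nz nz' by (simp add: divide_simps) (simp add: algebra_simps)
    qed
    also have "norm \<dots> \<le> (\<Sum>l\<in>A. 2 * norm (a l) * \<bar>e l - c\<bar> / n\<^sup>2)"
    proof (rule sum_norm_le)
      fix l assume l: "l \<in> A"
      have "norm (a l * of_real (e l - c) / ((s - of_real (e l)) * (s - of_real c)))
          = norm (a l) * \<bar>e l - c\<bar> / (norm (s - of_real (e l)) * n)"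
        by (simp add: norm_mult norm_divide n_def del: of_real_diff)
      also have "\<dots> \<le> norm (a l) * \<bar>e l - c\<bar> / (n / 2 * n)"
        using far[OF l] n by (intro divide_left_mono mult_right_mono mult_pos_pos) auto
      also have "\<dots> = 2 * norm (a l) * \<bar>e l - c\<bar> / n\<^sup>2" by (simp add: power2_eq_square)
      finally show "norm (a l * of_real (e l - c) / ((s - of_real (e l)) * (s - of_real c)))
          \<le> 2 * norm (a l) * \<bar>e l - c\<bar> / n\<^sup>2" .
    qed
    also have "\<dots> = C / n\<^sup>2" by (simp add: C_def sum_divide_distrib)
    finally show ?thesis by (simp add: n_def)
  qed
  show ?thesis
  proof (rule that[of C "2 * m + 1"])
    show "0 \<le> C" by (simp add: C_def sum_nonneg)
    show "0 < 2 * m + 1" using m0 by simp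
    show "\<bar>e l - c\<bar> < 2 * m + 1" if "l \<in> A" for l using m[OF that] m0 by linarith
  qed (rule bound)
qed

lemma norm_mult_decay:
  fixes R h :: complex
  assumes "norm R \<le> C / n\<^sup>2" "norm h \<le> B" "0 \<le> C"
  shows "norm (R * h) \<le> C * B / n\<^sup>2"
proof -
  have "norm (R * h) \<le> C / n\<^sup>2 * B"
    unfolding norm_mult using assms by (intro mult_mono) auto
  then show ?thesis by simp
qed

text \<open>All poles \<open>e l\<close> lie to the left of the line, so the integral around a
  rectangle to its right is zero by Cauchy's theorem.\<close>

lemma vertical_integral_close_right:
  fixes a :: "'i \<Rightarrow> complex" and e :: "'i \<Rightarrow> real" and b c B :: real
  assumes A: "finite A" "sum a A = 0" and e: "\<And>l. l \<in> A \<Longrightarrow> e l \<le> b" and bc: "b < c"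
    and h: "h holomorphic_on {s. b < Re s}"
    and bd: "\<And>s. c \<le> Re s \<Longrightarrow> norm (h s) \<le> B"
  shows "has_vertical_integral (\<lambda>s. (\<Sum>l\<in>A. a l / (s - of_real (e l))) * h s) 0 c"
proof -
  define f where "f = (\<lambda>s. (\<Sum>l\<in>A. a l / (s - of_real (e l))) * h s)"
  obtain C T where C: "0 \<le> C" and
    dec: "\<And>s. T \<le> norm (s - of_real c) \<Longrightarrow>
       norm (\<Sum>l\<in>A. a l / (s - of_real (e l))) \<le> C / (norm (s - of_real c))\<^sup>2"
    by (rule simple_fractions_decay[OF A, of e c]) blast
  have B: "0 \<le> B" using order_trans[OF norm_ge_zero bd[of "of_real c"]] by simp
  have holo: "f holomorphic_on {s. b < Re s}"
    unfolding f_def using e by (intro holomorphic_intros h) force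
  have cont: "continuous_on X f" if "X \<subseteq> {s. b < Re s}" for X
    using continuous_on_subset[OF holomorphic_on_imp_continuous_on[OF holo] that] .
  show ?thesis
    unfolding f_def[symmetric]
  proof (rule has_vertical_integral_rectangle_shift[where \<tau> = 1 and C = "C * B" and T = T])
    show "\<bar>1::real\<bar> = 1" "0 \<le> C * B" using C B by auto
    show "continuous_on {s. 0 \<le> 1 * (Re s - c) \<and> (Re s = c \<or> T \<le> norm (s - of_real c))} f"
      using bc by (intro cont) auto
    show "norm (f s) \<le> C * B / (norm (s - of_real c))\<^sup>2"
      if "s \<in> {s. 0 \<le> 1 * (Re s - c) \<and> (Re s = c \<or> T \<le> norm (s - of_real c))}"
         "T \<le> norm (s - of_real c)" for s
      using that C unfolding f_def by (intro norm_mult_decay dec bd) auto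
    show "eventually (\<lambda>t.
        contour_integral (linepath (Complex c (-t)) (Complex c t)) f
        - (contour_integral (linepath (Complex c (-t)) (Complex (c + 1 * t) (-t))) f
         + contour_integral (linepath (Complex (c + 1 * t) (-t)) (Complex (c + 1 * t) t)) f
         + contour_integral (linepath (Complex (c + 1 * t) t) (Complex c t)) f) = 0) at_top"
      using eventually_gt_at_top[of 0]
    proof eventually_elim
      case (elim t)
      let ?g = "rectpath (Complex c (-t)) (Complex (c + t) t)"
      have sub: "path_image ?g \<subseteq> {s. b < Re s}"
        using path_image_rectpath_subset_cbox[of "Complex c (-t)" "Complex (c + t) t"] elim bc
        by (fastforce simp: in_cbox_complex_iff)
      have "(f has_contour_integral 0) ?g"
        by (rule Cauchy_theorem_convex_simple[OF holo]) (use sub in \<open>auto simp: convex_halfspace_Re_gt\<close>)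
      then have "contour_integral ?g f = 0" by (rule contour_integral_unique)
      moreover have "contour_integral (linepath (Complex c t) (Complex c (-t))) f
          = - contour_integral (linepath (Complex c (-t)) (Complex c t)) f"
        by (rule contour_integral_reverse_linepath, rule cont)
           (use bc in \<open>auto dest!: segment_vertical\<close>)
      ultimately show ?case
        using contour_integral_rectpath_split[of c "c + t" "-t" t f] cont[OF sub] elim
        by (simp add: algebra_simps)
    qed
  qed
qed

text \<open>Once \<open>t\<close> exceeds the distance from \<open>c\<close> to every \<open>e l\<close>, the rectangle to
  the left of the line winds once around each pole.\<close>

lemma vertical_integral_close_left:
  fixes a :: "'i \<Rightarrow> complex" and e :: "'i \<Rightarrow> real" and c B :: real
  assumes A: "finite A" "sum a A = 0" and e: "\<And>l. l \<in> A \<Longrightarrow> e l < c"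
    and h: "h holomorphic_on UNIV"
    and bd: "\<And>s. Re s \<le> c \<Longrightarrow> norm (h s) \<le> B"
  shows "has_vertical_integral (\<lambda>s. (\<Sum>l\<in>A. a l / (s - of_real (e l))) * h s)
           (2 * of_real pi * \<i> * (\<Sum>l\<in>A. a l * h (of_real (e l)))) c"
proof -
  define f where "f = (\<lambda>s. (\<Sum>l\<in>A. a l / (s - of_real (e l))) * h s)"
  define J where "J = 2 * of_real pi * \<i> * (\<Sum>l\<in>A. a l * h (of_real (e l)))"
  obtain C T where C: "0 \<le> C" and T: "0 < T" "\<And>l. l \<in> A \<Longrightarrow> \<bar>e l - c\<bar> < T" and
    dec: "\<And>s. T \<le> norm (s - of_real c) \<Longrightarrow>
       norm (\<Sum>l\<in>A. a l / (s - of_real (e l))) \<le> C / (norm (s - of_real c))\<^sup>2"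
    by (rule simple_fractions_decay[OF A, of e c]) blast
  have B: "0 \<le> B" using order_trans[OF norm_ge_zero bd[of "of_real c"]] by simp
  have "f holomorphic_on UNIV - (\<lambda>l. of_real (e l)) ` A"
    unfolding f_def by (intro holomorphic_intros holomorphic_on_subset[OF h]) auto
  then have cont: "continuous_on X f" if "X \<inter> (\<lambda>l. of_real (e l)) ` A = {}" for X
    by (rule continuous_on_subset[OF holomorphic_on_imp_continuous_on]) (use that in blast)
  have far: "s \<noteq> of_real (e l)" if "l \<in> A" "Re s = c \<or> T \<le> norm (s - of_real c)" for s l
    using e[OF that(1)] T(2)[OF that(1)] that(2) by (auto simp flip: of_real_diff)
  show ?thesis
    unfolding f_def[symmetric] J_def[symmetric]
  proof (rule has_vertical_integral_rectangle_shift[where \<tau> = "-1" and C = "C * B" and T = T])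
    show "\<bar>-1::real\<bar> = 1" "0 \<le> C * B" using C B by auto
    show "continuous_on {s. 0 \<le> -1 * (Re s - c) \<and> (Re s = c \<or> T \<le> norm (s - of_real c))} f"
      using far by (intro cont) blast
    show "norm (f s) \<le> C * B / (norm (s - of_real c))\<^sup>2"
      if "s \<in> {s. 0 \<le> -1 * (Re s - c) \<and> (Re s = c \<or> T \<le> norm (s - of_real c))}"
         "T \<le> norm (s - of_real c)" for s
      using that C unfolding f_def by (intro norm_mult_decay dec bd) auto
    show "eventually (\<lambda>t.
        contour_integral (linepath (Complex c (-t)) (Complex c t)) f
        - (contour_integral (linepath (Complex c (-t)) (Complex (c + -1 * t) (-t))) f
         + contour_integral (linepath (Complex (c + -1 * t) (-t)) (Complex (c + -1 * t) t)) f
         + contour_integral (linepath (Complex (c + -1 * t) t) (Complex c t)) f) = J) at_top"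
      using eventually_ge_at_top[of T]
    proof eventually_elim
      case (elim t)
      have t: "0 < t" "T \<le> t" using T elim by auto
      let ?g = "rectpath (Complex (c - t) (-t)) (Complex c t)"
      have inbox: "of_real (e l) \<in> box (Complex (c - t) (-t)) (Complex c t)" if "l \<in> A" for l
        using e[OF that] T(2)[OF that] t by (auto simp: in_box_complex_iff)
      have off: "path_image ?g \<inter> (\<lambda>l. of_real (e l)) ` A = {}"
        using path_image_rectpath_inter_box[of "Complex (c - t) (-t)" "Complex c t"] inbox t by auto
      have one: "((\<lambda>s. h s / (s - of_real (e l))) has_contour_integral
          2 * of_real pi * \<i> * h (of_real (e l))) ?g" if "l \<in> A" for l
      proof -
        have "path_image ?g \<subseteq> UNIV - {of_real (e l)}" using off that by blast
        then show ?thesis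
          using Cauchy_integral_formula_convex_simple[OF convex_UNIV h, of "of_real (e l)" ?g]
          by (simp add: winding_number_rectpath[OF inbox[OF that]])
      qed
      have "((\<lambda>s. \<Sum>l\<in>A. a l * (h s / (s - of_real (e l)))) has_contour_integral
          (\<Sum>l\<in>A. a l * (2 * of_real pi * \<i> * h (of_real (e l))))) ?g"
        by (intro has_contour_integral_sum has_contour_integral_lmul A one)
      moreover have "(\<lambda>s. \<Sum>l\<in>A. a l * (h s / (s - of_real (e l)))) = f"
        by (simp add: f_def sum_distrib_right)
      moreover have "(\<Sum>l\<in>A. a l * (2 * of_real pi * \<i> * h (of_real (e l)))) = J"
        by (simp add: J_def sum_distrib_left mult_ac)
      ultimately have "(f has_contour_integral J) ?g"
        by simp
      then have J: "contour_integral ?g f = J" by (rule contour_integral_unique)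
      have off': "closed_segment z w \<inter> (\<lambda>l. of_real (e l)) ` A = {}"
        if "closed_segment z w \<subseteq> {s. T \<le> norm (s - of_real c)}" for z w :: complex
      proof (rule equals0I)
        fix s assume "s \<in> closed_segment z w \<inter> (\<lambda>l. of_real (e l)) ` A"
        then obtain l where "l \<in> A" "s = of_real (e l)" "s \<in> closed_segment z w" by auto
        then show False using far[of l s] that by blast
      qed
      have im: "T \<le> norm (s - of_real c)" if "\<bar>Im s\<bar> = t" for s
        using norm_diff_of_real_ge(2)[of s c] that t by linarith
      have re: "T \<le> norm (s - of_real c)" if "Re s = c - t" for s
        using norm_diff_of_real_ge(1)[of s c] that t by linarith
      have r1: "contour_integral (linepath (Complex (c - t) (-t)) (Complex c (-t))) f
          = - contour_integral (linepath (Complex c (-t)) (Complex (c - t) (-t))) f"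
        by (rule contour_integral_reverse_linepath, rule cont, rule off', rule subsetI, drule segment_horizontal)
           (use im t in auto)
      have r2: "contour_integral (linepath (Complex c t) (Complex (c - t) t)) f
          = - contour_integral (linepath (Complex (c - t) t) (Complex c t)) f"
        by (rule contour_integral_reverse_linepath, rule cont, rule off', rule subsetI, drule segment_horizontal)
           (use im t in auto)
      have r3: "contour_integral (linepath (Complex (c - t) t) (Complex (c - t) (-t))) f
          = - contour_integral (linepath (Complex (c - t) (-t)) (Complex (c - t) t)) f"
        by (rule contour_integral_reverse_linepath, rule cont, rule off', rule subsetI, drule segment_vertical)
           (use re t in auto)
      \<comment> \<open>The rectangle runs counterclockwise, so the segment on the line is traversed upwards and the
        other three sides opposite to the shifted path.\<close>
      have split: "J = contour_integral (linepath (Complex (c - t) (-t)) (Complex c (-t))) f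
          + contour_integral (linepath (Complex c (-t)) (Complex c t)) f
          + contour_integral (linepath (Complex c t) (Complex (c - t) t)) f
          + contour_integral (linepath (Complex (c - t) t) (Complex (c - t) (-t))) f"
        unfolding J[symmetric]
        by (rule contour_integral_rectpath_split) (use t cont[OF off] in auto)
      have shift: "c + -1 * t = c - t" by simp
      have alg: "L - (X + Y + Z) = - X + L + - Z + - Y" for L X Y Z :: complex by simp
      show ?case
        unfolding shift split r1 r2 r3 by (rule alg)
    qed
  qed
qed

section \<open>The zeta-function and the symbolic volume\<close>

lemma norm_of_real_powr: "0 \<le> x \<Longrightarrow> norm (of_real x powr s :: complex) = x powr Re s"
  by (simp add: norm_powr_real_powr)

text \<open>The sum is strictly decreasing in the exponent and equals \<open>1\<close> at \<open>\<beta> q\<close>.\<close>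

lemma powr_sum_less_one:
  assumes \<rho>: "\<And>i. i \<in> {1..N} \<Longrightarrow> 0 < \<rho> i \<and> \<rho> i < 1" and p: "\<And>i. i \<in> {1..N} \<Longrightarrow> 0 < p i"
    and N: "1 \<le> N" and t: "mf_beta N \<rho> p q < t"
  shows "(\<Sum>i=1..N. p i powr q * \<rho> i powr t) < 1"
proof -
  have "(\<Sum>i=1..N. p i powr q * \<rho> i powr t) < (\<Sum>i=1..N. p i powr q * \<rho> i powr mf_beta N \<rho> p q)"
  proof (rule sum_strict_mono)
    fix i assume i: "i \<in> {1..N}"
    have "\<rho> i powr t < \<rho> i powr mf_beta N \<rho> p q"
      using \<rho>[OF i] t by (intro powr_less_mono') auto
    then show "p i powr q * \<rho> i powr t < p i powr q * \<rho> i powr mf_beta N \<rho> p q"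
      using p[OF i] by (intro mult_strict_left_mono) auto
  qed (use N in auto)
  also have "\<dots> = 1"
    using theI'[OF mf_beta_ex1[OF \<rho> p N]] by (simp add: mf_beta_def)
  finally show ?thesis .
qed

text \<open>This bounds both the letter sum \<open>P\<close>, with bases \<open>\<rho> i\<close>, and the cut-set sum, with bases
  \<open>\<rho>\<^sub>w / r\<close>, uniformly on a right half-plane.\<close>

lemma norm_powr_sum_le:
  fixes s :: complex
  assumes "\<And>i. i \<in> I \<Longrightarrow> 0 < x i \<and> x i \<le> 1" "\<And>i. i \<in> I \<Longrightarrow> 0 \<le> k i" "c \<le> Re s"
  shows "norm (\<Sum>i\<in>I. of_real (k i) * of_real (x i) powr s) \<le> (\<Sum>i\<in>I. k i * x i powr c)"
proof (rule sum_norm_le)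
  fix i assume i: "i \<in> I"
  have "x i powr Re s \<le> x i powr c"
    using assms(1)[OF i] assms(3) by (intro powr_mono') auto
  then show "norm (of_real (k i) * of_real (x i) powr s) \<le> k i * x i powr c"
    using assms(1,2)[OF i] by (simp add: norm_mult norm_of_real_powr mult_left_mono)
qed

text \<open>The finite sum carries the words that matter at scale \<open>r\<close>. Every word beyond
  them is a cut-set word followed by an arbitrary, possibly empty, word, and the arbitrary words add
  up to \<open>1 / (1 - P)\<close>. As an identity of quotients it holds wherever \<open>P \<noteq> 1\<close>, without
  regard to convergence.\<close>

lemma mf_zeta_cut_set:
  fixes s :: complex
  assumes \<rho>: "\<And>i. i \<in> {1..N} \<Longrightarrow> 0 < \<rho> i \<and> \<rho> i < 1" and p: "\<And>i. i \<in> {1..N} \<Longrightarrow> 0 < p i"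
    and r: "0 < r" "r < 1"
    and P: "(\<Sum>i=1..N. of_real (p i powr q) * of_real (\<rho> i) powr s) \<noteq> 1"
  shows "mf_zeta N \<rho> p q s =
      (\<Sum>w | w \<in> words N \<and> r \<le> word_prod \<rho> w.
          of_real (word_prod p w powr q) * of_real (word_prod \<rho> w) powr s)
    + (\<Sum>w | w \<in> words N \<and> word_prod \<rho> w < r \<and> r \<le> word_prod \<rho> (butlast w).
          of_real (word_prod p w powr q) * of_real (word_prod \<rho> w) powr s)
      / (1 - (\<Sum>i=1..N. of_real (p i powr q) * of_real (\<rho> i) powr s))"
proof -
  define g :: "nat \<Rightarrow> complex" where "g = (\<lambda>i. of_real (p i powr q) * of_real (\<rho> i) powr s)"
  define P where "P = (\<Sum>i=1..N. g i)"
  have eq: "(\<Sum>w | w \<in> words N \<and> Q w. of_real (word_prod p w powr q) * of_real (word_prod \<rho> w) powr s)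
      = (\<Sum>w | w \<in> words N \<and> Q w. prod_list (map g w))" for Q
    unfolding g_def
    by (rule sum.cong[OF refl], rule word_weight_eq_prod_list_complex[OF \<rho>[THEN conjunct1] p])
       (auto simp: words_def)
  have "P \<noteq> 1" using P by (simp add: P_def g_def)
  moreover have "P / (1 - P) = W + U / (1 - P)" if "P * (1 + W) = W + U" "P \<noteq> 1" for W U :: complex
  proof -
    have "U = P - W * (1 - P)" using that(1) by (simp add: algebra_simps)
    then show ?thesis using that(2) by (simp add: diff_divide_distrib)
  qed
  ultimately show ?thesis
    unfolding mf_zeta_def eq g_def[symmetric, THEN fun_cong] P_def[symmetric]
    using cut_set_identity[of N \<rho> r g, OF \<rho> r, folded P_def] by blast
qed

theorem theorem5p4:
  fixes S :: "nat \<Rightarrow> 'a::euclidean_space \<Rightarrow> 'a"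
    and K :: "'a set" and \<mu> :: "'a measure"
    and N d :: nat and \<rho> p \<kappa> :: "nat \<Rightarrow> real" and q c r :: real
  assumes "N \<ge> 2"
    and "d = DIM('a)"
    and "\<forall>i\<in>{1..N}. contracting_similarity (\<rho> i) (S i)"
    and "\<forall>i\<in>{1..N}. p i > 0"
    and "(\<Sum>i=1..N. p i) = 1"
    and "self_similar_set N S K"
    and "self_similar_measure N S p \<mu>"
    and "(\<Sum>l=0..d. \<kappa> l * (mf_sigma N \<rho> p d q l - 1)) = 0"
    and "c > Max (insert (mf_beta N \<rho> p q) ((\<lambda>l. real l - real d * q) ` {0..d}))"
    and "0 < r"
    and "r < Min (\<rho> ` {1..N})"
  shows "\<exists>I. has_vertical_integral
               (\<lambda>s. modified_zeta N \<rho> p d q \<kappa> s * of_real r powr (- s)) I c \<and>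
             complex_of_real (sym_minkowski_volume N \<rho> p d q \<kappa> r) =
               of_real (\<Sum>l=0..d. \<kappa> l * mf_sigma N \<rho> p d q l * r powr (- real l + real d * q))
               + 1 / (2 * of_real pi * \<i>) * I"
proof -
  have N: "1 \<le> N" using \<open>N \<ge> 2\<close> by simp
  have \<rho>: "0 < \<rho> i \<and> \<rho> i < 1" if "i \<in> {1..N}" for i
    using assms(3) that by (auto simp: contracting_similarity_def)
  have p: "0 < p i" if "i \<in> {1..N}" for i using assms(4) that by blast
  have "r < \<rho> 1"
    using assms(11) by (rule less_le_trans) (use N in \<open>auto intro!: Min_le\<close>)
  then have r: "0 < r" "r < 1" using assms(10) \<rho>[of 1] N by auto
  define b where "b = Max (insert (mf_beta N \<rho> p q) ((\<lambda>l. real l - real d * q) ` {0..d}))"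
  define a where "a = (\<lambda>l. \<kappa> l * (mf_sigma N \<rho> p d q l - 1))"
  define e where "e = (\<lambda>l. real l - real d * q)"
  define R where "R = (\<lambda>s. \<Sum>l=0..d. complex_of_real (a l) / (s - of_real (e l)))"
  define P where "P = (\<lambda>s. \<Sum>i=1..N. complex_of_real (p i powr q) * of_real (\<rho> i) powr s)"
  define W where "W = {w. w \<in> words N \<and> r \<le> word_prod \<rho> w}"
  define U where "U = {w. w \<in> words N \<and> word_prod \<rho> w < r \<and> r \<le> word_prod \<rho> (butlast w)}"
  define h where "h = (\<lambda>w s. complex_of_real (word_prod \<rho> w / r) powr s)"
  define H where "H = (\<lambda>s. (\<Sum>w\<in>U. of_real (word_prod p w powr q) * h w s) / (1 - P s))"
  have bc: "b < c" using assms(9) by (simp add: b_def)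
  have b: "mf_beta N \<rho> p q \<le> b" "\<And>l. l \<in> {0..d} \<Longrightarrow> e l \<le> b"
    unfolding b_def e_def by (rule Max_ge; auto)+
  have a: "(\<Sum>l=0..d. complex_of_real (a l)) = 0"
    by (simp only: a_def of_real_sum[symmetric] assms(8) of_real_0)
  have pos: "0 < word_prod \<rho> w" if "w \<in> words N" for w
    using that \<rho> by (intro word_prod_pos[of N]) (auto simp: words_def)
  have finW: "finite W" unfolding W_def using finite_words_ge[of N \<rho>, OF \<rho> r(1)] by simp
  have h_holo: "h w holomorphic_on X" if "w \<in> words N" for w X
    using pos[OF that] r unfolding h_def by (auto simp: powr_def intro!: holomorphic_intros)
  have h_eq: "h w s = of_real (word_prod \<rho> w) powr s * of_real r powr (- s)" if "w \<in> words N" for w s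
  proof -
    have "of_real (word_prod \<rho> w) powr s = (of_real (word_prod \<rho> w / r) * of_real r :: complex) powr s"
      using r by simp
    also have "\<dots> = h w s * of_real r powr s"
      unfolding h_def using pos[OF that] r by (subst powr_times_real) (auto simp del: of_real_divide)
    finally show ?thesis using r by (simp add: powr_minus)
  qed
  have P_lt: "(\<Sum>i=1..N. p i powr q * \<rho> i powr t) < 1" if "b < t" for t
    by (rule powr_sum_less_one[OF \<rho> p N]) (use that b in auto)
  have P_le: "norm (P s) \<le> (\<Sum>i=1..N. p i powr q * \<rho> i powr t)" if "t \<le> Re s" for s t
    unfolding P_def by (rule norm_powr_sum_le) (use \<rho> that less_imp_le in auto)
  have P1: "P s \<noteq> 1" if "b < Re s" for s
    using P_le[of "Re s" s] P_lt[OF that] by auto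

  \<comment> \<open>Words in W have base at least 1, so their powers are bounded to the left of the line.\<close>
  have left: "has_vertical_integral (\<lambda>s. R s * h w s)
      (2 * of_real pi * \<i> * (\<Sum>l=0..d. of_real (a l) * h w (of_real (e l)))) c" if w: "w \<in> W" for w
    unfolding R_def
  proof (rule vertical_integral_close_left[where B = "(word_prod \<rho> w / r) powr c"])
    show "e l < c" if "l \<in> {0..d}" for l using b(2)[OF that] bc by simp
    have ge: "1 \<le> word_prod \<rho> w / r" using w r by (simp add: W_def)
    show "norm (h w s) \<le> (word_prod \<rho> w / r) powr c" if "Re s \<le> c" for s
      using ge that unfolding h_def by (subst norm_of_real_powr) (auto intro!: powr_mono)
  qed (use a w in \<open>auto simp: W_def intro!: h_holo\<close>)

  \<comment> \<open>A bound on H for Re s at least c: every base in U is below 1, so the numerator is largest at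
    Re s = c, and so is the letter sum that keeps the denominator away from zero.\<close>
  define B where "B = (\<Sum>w\<in>U. word_prod p w powr q * (word_prod \<rho> w / r) powr c)
      / (1 - (\<Sum>i=1..N. p i powr q * \<rho> i powr c))"
  have right: "has_vertical_integral (\<lambda>s. R s * H s) 0 c"
    unfolding R_def
  proof (rule vertical_integral_close_right[where b = b and B = B])
    show "H holomorphic_on {s. b < Re s}"
    proof -
      have "(\<lambda>s. complex_of_real (\<rho> i) powr s) holomorphic_on {s. b < Re s}" if "i \<in> {1..N}" for i
        using \<rho>[OF that] by (auto simp: powr_def intro!: holomorphic_intros)
      then have "P holomorphic_on {s. b < Re s}"
        unfolding P_def by (intro holomorphic_on_sum holomorphic_on_mult holomorphic_on_const)
      moreover have "(\<lambda>s. \<Sum>w\<in>U. of_real (word_prod p w powr q) * h w s) holomorphic_on {s. b < Re s}"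
        by (intro holomorphic_on_sum holomorphic_on_mult holomorphic_on_const h_holo) (simp add: U_def)
      ultimately show ?thesis
        unfolding H_def using P1 by (intro holomorphic_on_divide holomorphic_on_diff holomorphic_on_const) auto
    qed
    fix s assume s: "c \<le> Re s"
    have "norm (\<Sum>w\<in>U. of_real (word_prod p w powr q) * h w s)
        \<le> (\<Sum>w\<in>U. word_prod p w powr q * (word_prod \<rho> w / r) powr c)"
      unfolding h_def by (rule norm_powr_sum_le) (use s r pos in \<open>auto simp: U_def\<close>)
    moreover have "1 - (\<Sum>i=1..N. p i powr q * \<rho> i powr c) \<le> norm (1 - P s)"
      using P_le[OF s] norm_triangle_ineq2[of 1 "P s"] by simp
    ultimately show "norm (H s) \<le> B"
      unfolding H_def B_def norm_divide using P_lt[OF bc]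
      by (intro frac_le) (auto intro!: sum_nonneg)
  qed (use a b bc in auto)

  define I where "I = (\<Sum>w\<in>W. of_real (word_prod p w powr q) *
      (2 * of_real pi * \<i> * (\<Sum>l=0..d. of_real (a l) * h w (of_real (e l))))) + 0"
  have "has_vertical_integral (\<lambda>s. (\<Sum>w\<in>W. of_real (word_prod p w powr q) * (R s * h w s)) + R s * H s) I c"
    unfolding I_def
    by (intro has_vertical_integral_add has_vertical_integral_sum has_vertical_integral_cmult
          finW left right)
  then have int: "has_vertical_integral (\<lambda>s. modified_zeta N \<rho> p d q \<kappa> s * of_real r powr (- s)) I c"
  proof (rule has_vertical_integral_cong)
    fix s :: complex assume "Re s = c"
    then have P: "P s \<noteq> 1" using P1 bc by simp
    define Z where "Z = (\<lambda>X. \<Sum>w\<in>X. complex_of_real (word_prod p w powr q) * of_real (word_prod \<rho> w) powr s)"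
    have Z: "(\<Sum>w\<in>X. of_real (word_prod p w powr q) * h w s) = Z X * of_real r powr (- s)"
      if "X \<subseteq> words N" for X
      unfolding Z_def sum_distrib_right using that by (intro sum.cong refl) (auto simp: h_eq)
    have ZW: "(\<Sum>w\<in>W. of_real (word_prod p w powr q) * h w s) = Z W * of_real r powr (- s)"
      and ZU: "(\<Sum>w\<in>U. of_real (word_prod p w powr q) * h w s) = Z U * of_real r powr (- s)"
      by (rule Z, force simp: W_def U_def)+
    have "mf_zeta N \<rho> p q s = Z W + Z U / (1 - P s)"
      unfolding Z_def W_def U_def P_def
      by (rule mf_zeta_cut_set[OF \<rho> p r P[unfolded P_def]])
    then have "modified_zeta N \<rho> p d q \<kappa> s = R s * (Z W + Z U / (1 - P s))"
      by (simp only: modified_zeta_def R_def a_def e_def)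
    moreover have "(\<Sum>w\<in>W. of_real (word_prod p w powr q) * (R s * h w s)) = R s * (Z W * of_real r powr (- s))"
      unfolding ZW[symmetric] by (simp add: sum_distrib_left mult_ac)
    moreover have "H s = Z U / (1 - P s) * of_real r powr (- s)"
      unfolding H_def ZU by simp
    ultimately show "(\<Sum>w\<in>W. of_real (word_prod p w powr q) * (R s * h w s)) + R s * H s =
        modified_zeta N \<rho> p d q \<kappa> s * of_real r powr (- s)"
      by (simp add: algebra_simps)
  qed

  have "1 / (2 * of_real pi * \<i>) * I =
      (\<Sum>w\<in>W. of_real (word_prod p w powr q) * (\<Sum>l=0..d. of_real (a l) * h w (of_real (e l))))"
    unfolding I_def by (simp add: sum_distrib_left sum_divide_distrib mult.left_commute)
  also have "\<dots> = of_real (\<Sum>w\<in>W. word_prod p w powr q * (\<Sum>l=0..d. a l * (word_prod \<rho> w / r) powr e l))"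
  proof -
    have "h w (of_real (e l)) = of_real ((word_prod \<rho> w / r) powr e l)" if "w \<in> W" for w l
      using that r unfolding h_def by (intro powr_of_real) (auto simp: W_def)
    then show ?thesis by simp
  qed
  finally have I: "1 / (2 * of_real pi * \<i>) * I =
      of_real (\<Sum>w\<in>W. word_prod p w powr q * (\<Sum>l=0..d. a l * (word_prod \<rho> w / r) powr e l))" .
  have "sym_minkowski_volume N \<rho> p d q \<kappa> r =
      (\<Sum>l=0..d. \<kappa> l * mf_sigma N \<rho> p d q l * r powr (- real l + real d * q))
      + (\<Sum>w\<in>W. word_prod p w powr q * (\<Sum>l=0..d. a l * (word_prod \<rho> w / r) powr e l))"
    unfolding a_def e_def W_def by (rule sym_minkowski_volume_eq[OF \<rho> p N r assms(8)])
  then have "of_real (sym_minkowski_volume N \<rho> p d q \<kappa> r) =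
      of_real (\<Sum>l=0..d. \<kappa> l * mf_sigma N \<rho> p d q l * r powr (- real l + real d * q))
      + 1 / (2 * of_real pi * \<i>) * I"
    unfolding I by (simp only: of_real_add)
  with int show ?thesis by blast
qed

end
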